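(* Let $E$ be a separable Banach space, $\phi$ a Young integrand on $\Omega\times E$, $f:\Omega\times E\to\overline{\mathbb{R}}$ a measurable integrand, and $x_0\in L_\phi(\Omega,E)$ with $f(\omega,x_0(\omega))$ finite for almost every $\omega$. Suppose that for every $\epsilon>0$ and every $\lambda>0$ there exists a family $\{u_r: r\in(0,1)\}$ of non negative functions which, for $r$ small enough, are integrable and form a uniformly integrable family in $L_1(\Omega,\mathbb{R})$, such that for all sufficiently small $r>0$ $$[f](x_0,\cdot,r)\ \ge\ -\epsilon\,\phi_\lambda-u_r .$$ Then $f$ has the Fréchet-differential lower compactness property on $L_\phi(\Omega,E)$ at $x_0$.
   Context: $(\Omega,\mathbb{T},\mu)$ is a measure space with $\mu$ a $\sigma$-finite positive measure and $\mathbb{T}$ $\mu$-complete. A measurable integrand is a $\mathbb{T}\otimes\mathcal{B}(E)$-measurable function $\Omega\times E\to\overline{\mathbb{R}}$. For integrands, $g\ge h$ means that there is a negligible set $N$ with $g(\omega,e)\ge h(\omega,e)$ for all $\omega\notin N$, $e\in E$. $[f](x_0,\cdot,r)$ is the integrand $(\omega,e)\mapsto r^{-1}(f(\omega,x_0(\omega)+re)-f(\omega,x_0(\omega)))$. A Young function is a convex even function $E\to\overline{\mathbb{R}}_+$, continuous at $0$, vanishing at $0$, and tending to $+\infty$ as $\|e\|\to\infty$. A Young integrand is $\phi:\Omega\times E\to\overline{\mathbb{R}}_+$ with $\phi(\omega,\cdot)$ a Young function for every $\omega$; $\phi_\lambda(\omega,e)=\phi(\omega,\lambda e)$. With $I_\phi(x)=\int^*_\Omega\phi(\omega,x(\omega))\,d\mu$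 (upper integral: $\int^*_\Omega v\,d\mu=\inf\{\int u\,d\mu: u\in L_1(\Omega,\mathbb{R}),u\ge v\text{ a.e.}\}$), $L_\phi(\Omega,E)$ is the set of classes of measurable $x:\Omega\to E$ with $x\in t\{I_\phi\le1\}$ for some $t>0$, normed by $\|x\|_\phi=\inf\{t>0: x\in t\{I_\phi\le1\}\}$. A subset $X$ of $L_1(\Omega,\mathbb{R})$ is uniformly integrable if it is bounded in $L_1$ and for every $\epsilon>0$ there are $\eta>0$ and a measurable $K$ of finite measure with $\sup_{u\in X}\|u1_A\|_1<\epsilon$ whenever $\mu(A)\le\eta$, and $\sup_{u\in X}\|u1_{K^c}\|_1<\epsilon$. $f$ has the Fréchet-differential lower compactness property on a normed space $\mathcal{X}$ of measurable functions at $x_0$ if for every sequence $(r_n)_n$ of positive numbers converging to $0$ and every norm bounded sequence $(x_n)_n$ in $\mathcal{X}$ there is $n_0$ such that the negative parts $([f]^-(x_0,x_n,r_n))_{n\ge n_0}$ form a uniformly integrable family in $L_1(\Omega,\mathbb{R})$. *)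

theory Defs
  imports "HOL-Analysis.Analysis"
begin

text \<open>
  Integrands on \<open>\<Omega> \<times> E\<close> are functions on pairs with values in \<^typ>\<open>ereal\<close>. Classes of measurable
  functions modulo equality almost everywhere are represented by their members.
\<close>

definition measurable_integrand ::
    "'a measure \<Rightarrow> ('a \<times> 'e::topological_space \<Rightarrow> ereal) \<Rightarrow> bool" where
  "measurable_integrand M f \<longleftrightarrow> f \<in> borel_measurable (M \<Otimes>\<^sub>M borel)"

definition integrand_ge ::
    "'a measure \<Rightarrow> ('a \<times> 'e \<Rightarrow> ereal) \<Rightarrow> ('a \<times> 'e \<Rightarrow> ereal) \<Rightarrow> bool" where
  "integrand_ge M g h \<longleftrightarrow> (AE \<omega> in M. \<forall>e. g (\<omega>, e) \<ge> h (\<omega>, e))"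

text \<open>
  Below, \<open>f (\<omega>, x0 \<omega>)\<close> is always assumed finite for almost every \<open>\<omega>\<close>, so the value that
  \<^typ>\<open>ereal\<close> assigns to \<open>\<infinity> - \<infinity>\<close> only matters on a negligible set.
\<close>

definition diff_quotient ::
    "('a \<times> 'e::real_vector \<Rightarrow> ereal) \<Rightarrow> ('a \<Rightarrow> 'e) \<Rightarrow> real \<Rightarrow> 'a \<times> 'e \<Rightarrow> ereal" where
  "diff_quotient f x0 r =
     (\<lambda>(\<omega>, e). ereal (inverse r) * (f (\<omega>, x0 \<omega> + r *\<^sub>R e) - f (\<omega>, x0 \<omega>)))"

definition neg_part :: "ereal \<Rightarrow> ereal" where
  "neg_part a = max (- a) 0"

text \<open>The library's \<^const>\<open>convex_on\<close> only covers real-valued functions.\<close>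

definition young_function :: "('e::real_normed_vector \<Rightarrow> ereal) \<Rightarrow> bool" where
  "young_function \<psi> \<longleftrightarrow>
     (\<forall>e. 0 \<le> \<psi> e) \<and>
     (\<forall>x y t. 0 \<le> t \<and> t \<le> 1 \<longrightarrow>
        \<psi> ((1 - t) *\<^sub>R x + t *\<^sub>R y) \<le> ereal (1 - t) * \<psi> x + ereal t * \<psi> y) \<and>
     (\<forall>e. \<psi> (- e) = \<psi> e) \<and>
     isCont \<psi> 0 \<and>
     \<psi> 0 = 0 \<and>
     (\<psi> \<longlongrightarrow> \<infinity>) at_infinity"

text \<open>No measurability of \<open>\<phi>\<close> is required; this is why \<open>I_phi\<close> below is an upper integral.\<close>

definition young_integrand ::
    "'a measure \<Rightarrow> ('a \<times> 'e::real_normed_vector \<Rightarrow> ereal) \<Rightarrow> bool" where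
  "young_integrand M \<phi> \<longleftrightarrow> (\<forall>\<omega>\<in>space M. young_function (\<lambda>e. \<phi> (\<omega>, e)))"

definition scaled_integrand ::
    "('a \<times> 'e::real_vector \<Rightarrow> ereal) \<Rightarrow> real \<Rightarrow> 'a \<times> 'e \<Rightarrow> ereal" where
  "scaled_integrand \<phi> l = (\<lambda>(\<omega>, e). \<phi> (\<omega>, l *\<^sub>R e))"

definition upper_integral :: "'a measure \<Rightarrow> ('a \<Rightarrow> ereal) \<Rightarrow> ereal" where
  "upper_integral M v =
     (INF u\<in>{u :: 'a \<Rightarrow> real. integrable M u \<and> (AE \<omega> in M. ereal (u \<omega>) \<ge> v \<omega>)}.
        ereal (\<integral>\<omega>. u \<omega> \<partial>M))"

definition I_phi :: "'a measure \<Rightarrow> ('a \<times> 'e \<Rightarrow> ereal) \<Rightarrow> ('a \<Rightarrow> 'e) \<Rightarrow> ereal" where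
  "I_phi M \<phi> x = upper_integral M (\<lambda>\<omega>. \<phi> (\<omega>, x \<omega>))"

text \<open>The dilated sublevel set \<open>t {I_phi \<le> 1}\<close>.\<close>

definition dilated_ball ::
    "'a measure \<Rightarrow> ('a \<times> 'e::real_normed_vector \<Rightarrow> ereal) \<Rightarrow> real \<Rightarrow> ('a \<Rightarrow> 'e) set" where
  "dilated_ball M \<phi> t = (\<lambda>y \<omega>. t *\<^sub>R y \<omega>) ` {y \<in> borel_measurable M. I_phi M \<phi> y \<le> 1}"

definition L_phi ::
    "'a measure \<Rightarrow> ('a \<times> 'e::real_normed_vector \<Rightarrow> ereal) \<Rightarrow> ('a \<Rightarrow> 'e) set" where
  "L_phi M \<phi> = {x \<in> borel_measurable M. \<exists>t>0. x \<in> dilated_ball M \<phi> t}"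

definition norm_phi ::
    "'a measure \<Rightarrow> ('a \<times> 'e::real_normed_vector \<Rightarrow> ereal) \<Rightarrow> ('a \<Rightarrow> 'e) \<Rightarrow> real" where
  "norm_phi M \<phi> x = Inf {t. t > 0 \<and> x \<in> dilated_ball M \<phi> t}"

text \<open>
  The \<open>L\<^sub>1\<close>-norm is taken in \<^typ>\<open>ennreal\<close>, so that suprema over arbitrary (also unbounded or
  empty) sets of functions have their usual meaning.
\<close>

definition L1_norm :: "'a measure \<Rightarrow> ('a \<Rightarrow> real) \<Rightarrow> ennreal" where
  "L1_norm M u = (\<integral>\<^sup>+ \<omega>. ennreal \<bar>u \<omega>\<bar> \<partial>M)"

definition uniformly_integrable :: "'a measure \<Rightarrow> ('a \<Rightarrow> real) set \<Rightarrow> bool" where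
  "uniformly_integrable M X \<longleftrightarrow>
     (\<forall>u\<in>X. integrable M u) \<and>
     (SUP u\<in>X. L1_norm M u) < \<infinity> \<and>
     (\<forall>\<epsilon>>0::real. \<exists>\<eta>>0::real. \<exists>K\<in>sets M. emeasure M K < \<infinity> \<and>
        (\<forall>A\<in>sets M. emeasure M A \<le> ennreal \<eta> \<longrightarrow>
           (SUP u\<in>X. L1_norm M (\<lambda>\<omega>. u \<omega> * indicator A \<omega>)) < ennreal \<epsilon>) \<and>
        (SUP u\<in>X. L1_norm M (\<lambda>\<omega>. u \<omega> * indicator (space M - K) \<omega>)) < ennreal \<epsilon>)"

text \<open>
  The normed space of measurable functions is given by its carrier \<open>X\<close> and its norm \<open>nrm\<close>.
  The negative parts are \<^typ>\<open>ereal\<close>-valued; that they lie in \<open>L\<^sub>1(\<Omega>, \<real>)\<close> means that they agree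
  almost everywhere (in particular are almost everywhere finite) with real integrable
  functions \<open>v n\<close>.
\<close>

definition frechet_lower_compactness ::
    "'a measure \<Rightarrow> ('a \<Rightarrow> 'e::real_vector) set \<Rightarrow> (('a \<Rightarrow> 'e) \<Rightarrow> real) \<Rightarrow>
     ('a \<times> 'e \<Rightarrow> ereal) \<Rightarrow> ('a \<Rightarrow> 'e) \<Rightarrow> bool" where
  "frechet_lower_compactness M X nrm f x0 \<longleftrightarrow>
     (\<forall>(r :: nat \<Rightarrow> real) (x :: nat \<Rightarrow> 'a \<Rightarrow> 'e).
        (\<forall>n. r n > 0) \<and> r \<longlonglongrightarrow> 0 \<and> (\<forall>n. x n \<in> X) \<and> (\<exists>C. \<forall>n. nrm (x n) \<le> C) \<longrightarrow>
        (\<exists>n0. \<exists>v :: nat \<Rightarrow> 'a \<Rightarrow> real.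
           (\<forall>n\<ge>n0. AE \<omega> in M. neg_part (diff_quotient f x0 (r n) (\<omega>, x n \<omega>)) = ereal (v n \<omega>)) \<and>
           uniformly_integrable M (v ` {n0..})))"

end

theory Submission
  imports Defs
begin

text \<open>
  Let \<open>(x\<^sub>n)\<close> be bounded in \<open>L\<^sub>\<phi>\<close>. Choosing \<open>l\<close> to be the inverse of a strict upper bound of the
  norms, every \<open>\<phi>\<^sub>l (\<omega>, x\<^sub>n \<omega>)\<close> is dominated almost everywhere by an integrable \<open>g\<^sub>n\<close> with integral
  at most 2 (lemma \<open>L_phi_majorant\<close>). The growth condition for this \<open>l\<close> and an arbitrary \<open>\<epsilon>\<close> then
  bounds the negative part of the difference quotient at \<open>x\<^sub>n\<close>, as soon as \<open>r\<^sub>n\<close> is small, by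
  \<open>\<epsilon> g\<^sub>n + u (r\<^sub>n)\<close>, a function of norm at most \<open>2\<epsilon>\<close> plus a member of a uniformly integrable
  family. The threshold for \<open>r\<^sub>n\<close> depends on \<open>\<epsilon>\<close>, but it excludes only finitely many indices, and finitely many integrable
  functions are uniformly integrable. So the negative parts lie, up to arbitrarily small error in
  \<open>L\<^sub>1\<close>, below a uniformly integrable family, and this forces them to be uniformly integrable
  themselves (lemma \<open>uniformly_integrable_approx\<close>). The case \<open>\<epsilon> = 1\<close> fixes the index \<open>n\<^sub>0\<close> from
  which on the negative parts are integrable at all.
\<close>

section \<open>Uniform integrability\<close>

lemma L1_norm_indicator_le:
  assumes [measurable]: "h \<in> borel_measurable M" "u \<in> borel_measurable M" "A \<in> sets M"
    and le: "AE \<omega> in M. \<bar>v \<omega>\<bar> \<le> \<bar>h \<omega>\<bar> + \<bar>u \<omega>\<bar>"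
  shows "L1_norm M (\<lambda>\<omega>. v \<omega> * indicator A \<omega>)
           \<le> L1_norm M h + L1_norm M (\<lambda>\<omega>. u \<omega> * indicator A \<omega>)"
proof -
  have "L1_norm M (\<lambda>\<omega>. v \<omega> * indicator A \<omega>)
          \<le> (\<integral>\<^sup>+ \<omega>. ennreal \<bar>h \<omega>\<bar> + ennreal \<bar>u \<omega> * indicator A \<omega>\<bar> \<partial>M)"
    unfolding L1_norm_def
  proof (intro nn_integral_mono_AE, use le in eventually_elim)
    case (elim \<omega>)
    show ?case
      using elim by (auto simp: indicator_def simp flip: ennreal_plus intro!: ennreal_leI)
  qed
  also have "\<dots> = L1_norm M h + L1_norm M (\<lambda>\<omega>. u \<omega> * indicator A \<omega>)"
    unfolding L1_norm_def by (subst nn_integral_add) auto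
  finally show ?thesis .
qed

lemma uniformly_integrableE:
  fixes \<epsilon> :: real
  assumes "uniformly_integrable M X" and "\<epsilon> > 0"
  obtains \<eta> :: real and K where "\<eta> > 0" "K \<in> sets M" "emeasure M K < \<infinity>"
    "\<forall>A\<in>sets M. emeasure M A \<le> ennreal \<eta> \<longrightarrow>
       (SUP u\<in>X. L1_norm M (\<lambda>\<omega>. u \<omega> * indicator A \<omega>)) < ennreal \<epsilon>"
    "(SUP u\<in>X. L1_norm M (\<lambda>\<omega>. u \<omega> * indicator (space M - K) \<omega>)) < ennreal \<epsilon>"
proof -
  from assms have "\<exists>\<eta>>0::real. \<exists>K\<in>sets M. emeasure M K < \<infinity> \<and>
        (\<forall>A\<in>sets M. emeasure M A \<le> ennreal \<eta> \<longrightarrow>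
           (SUP u\<in>X. L1_norm M (\<lambda>\<omega>. u \<omega> * indicator A \<omega>)) < ennreal \<epsilon>) \<and>
        (SUP u\<in>X. L1_norm M (\<lambda>\<omega>. u \<omega> * indicator (space M - K) \<omega>)) < ennreal \<epsilon>"
    unfolding uniformly_integrable_def by (elim conjE allE[of _ \<epsilon>] impE)
  then show ?thesis by (elim exE bexE conjE) (rule that)
qed

lemma uniformly_integrable_Un:
  assumes "uniformly_integrable M X" and "uniformly_integrable M Y"
  shows "uniformly_integrable M (X \<union> Y)"
  unfolding uniformly_integrable_def
proof (intro conjI allI impI)
  show "\<forall>u\<in>X \<union> Y. integrable M u"
    using assms by (auto simp: uniformly_integrable_def)
  show "(SUP u\<in>X \<union> Y. L1_norm M u) < \<infinity>"
    using assms by (simp add: uniformly_integrable_def SUP_union sup_max)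
  fix \<epsilon> :: real assume "\<epsilon> > 0"
  obtain a K where a: "a > 0" and K: "K \<in> sets M" "emeasure M K < \<infinity>"
    and aX: "\<forall>A\<in>sets M. emeasure M A \<le> ennreal a \<longrightarrow>
               (SUP u\<in>X. L1_norm M (\<lambda>\<omega>. u \<omega> * indicator A \<omega>)) < ennreal \<epsilon>"
    and KX: "(SUP u\<in>X. L1_norm M (\<lambda>\<omega>. u \<omega> * indicator (space M - K) \<omega>)) < ennreal \<epsilon>"
    by (rule uniformly_integrableE[OF assms(1) \<open>\<epsilon> > 0\<close>], rule that)
  obtain b L where b: "b > 0" and L: "L \<in> sets M" "emeasure M L < \<infinity>"
    and bY: "\<forall>A\<in>sets M. emeasure M A \<le> ennreal b \<longrightarrow>
               (SUP u\<in>Y. L1_norm M (\<lambda>\<omega>. u \<omega> * indicator A \<omega>)) < ennreal \<epsilon>"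
    and LY: "(SUP u\<in>Y. L1_norm M (\<lambda>\<omega>. u \<omega> * indicator (space M - L) \<omega>)) < ennreal \<epsilon>"
    by (rule uniformly_integrableE[OF assms(2) \<open>\<epsilon> > 0\<close>], rule that)
  have mono: "L1_norm M (\<lambda>\<omega>. u \<omega> * indicator (space M - (K \<union> L)) \<omega>)
      \<le> L1_norm M (\<lambda>\<omega>. u \<omega> * indicator (space M - B) \<omega>)" if "B \<subseteq> K \<union> L" for B and u :: "'a \<Rightarrow> real"
    unfolding L1_norm_def using that
    by (intro nn_integral_mono) (auto simp: indicator_def)
  have "(SUP u\<in>X. L1_norm M (\<lambda>\<omega>. u \<omega> * indicator (space M - (K \<union> L)) \<omega>)) < ennreal \<epsilon>"
    by (rule le_less_trans[OF SUP_subset_mono[OF order_refl mono[of K]] KX]) simp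
  moreover have "(SUP u\<in>Y. L1_norm M (\<lambda>\<omega>. u \<omega> * indicator (space M - (K \<union> L)) \<omega>)) < ennreal \<epsilon>"
    by (rule le_less_trans[OF SUP_subset_mono[OF order_refl mono[of L]] LY]) simp
  moreover have "emeasure M (K \<union> L) < \<infinity>"
    using K L emeasure_subadditive[of K M L] by (auto intro: le_less_trans)
  moreover have "emeasure M A \<le> ennreal a" "emeasure M A \<le> ennreal b"
    if "emeasure M A \<le> ennreal (min a b)" for A
    by (rule order_trans[OF that ennreal_leI], simp)+
  ultimately show "\<exists>\<eta>>0. \<exists>K\<in>sets M. emeasure M K < \<infinity> \<and>
        (\<forall>A\<in>sets M. emeasure M A \<le> ennreal \<eta> \<longrightarrow>
           (SUP u\<in>X \<union> Y. L1_norm M (\<lambda>\<omega>. u \<omega> * indicator A \<omega>)) < ennreal \<epsilon>) \<and>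
        (SUP u\<in>X \<union> Y. L1_norm M (\<lambda>\<omega>. u \<omega> * indicator (space M - K) \<omega>)) < ennreal \<epsilon>"
    using a b K L aX bY
    by (intro exI[of _ "min a b"] conjI bexI[of _ "K \<union> L"]) (simp_all add: SUP_union sup_max)
qed

text \<open>
  Cutting \<open>u\<close> down to the set \<open>K\<close> where \<open>1/n \<le> \<bar>u\<bar> \<le> n\<close> costs little in \<open>L\<^sub>1\<close> for large \<open>n\<close>, by
  dominated convergence. The lower bound on \<open>K\<close> gives it finite measure, and the upper bound makes
  the integral of \<open>u\<close> over a subset of \<open>K\<close> small with the measure of that subset.
\<close>

lemma uniformly_integrable_singleton:
  assumes u: "integrable M u"
  shows "uniformly_integrable M {u}"
  unfolding uniformly_integrable_def
proof (intro conjI allI impI)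
  show "\<forall>v\<in>{u}. integrable M v" using u by simp
  show "(SUP v\<in>{u}. L1_norm M v) < \<infinity>"
    using u by (simp add: L1_norm_def integrable_iff_bounded)
  have [measurable]: "u \<in> borel_measurable M" using u by simp
  fix \<epsilon> :: real assume \<epsilon>: "\<epsilon> > 0"
  define K where "K n = {\<omega> \<in> space M. 1 / real (Suc n) \<le> \<bar>u \<omega>\<bar> \<and> \<bar>u \<omega>\<bar> \<le> real (Suc n)}" for n
  have Km [measurable]: "K n \<in> sets M" for n unfolding K_def by measurable
  have "(\<lambda>n. \<integral>\<^sup>+ \<omega>. ennreal \<bar>u \<omega> * indicator (space M - K n) \<omega>\<bar> \<partial>M) \<longlonglongrightarrow> (\<integral>\<^sup>+ \<omega>. 0 \<partial>M)"
  proof (rule nn_integral_dominated_convergence[where w = "\<lambda>\<omega>. ennreal \<bar>u \<omega>\<bar>"])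
    show "(\<integral>\<^sup>+ \<omega>. ennreal \<bar>u \<omega>\<bar> \<partial>M) < \<infinity>"
      using u by (simp add: integrable_iff_bounded)
    have "(\<lambda>n. ennreal \<bar>u \<omega> * indicator (space M - K n) \<omega>\<bar>) \<longlonglongrightarrow> 0" if "\<omega> \<in> space M" for \<omega>
    proof (cases "u \<omega> = 0")
      case False
      have "\<forall>\<^sub>F n in sequentially. 1 / real (Suc n) < \<bar>u \<omega>\<bar>"
        using False order_tendstoD(2)[OF lim_1_over_n[THEN LIMSEQ_Suc], of "\<bar>u \<omega>\<bar>"] by simp
      moreover have "\<forall>\<^sub>F n in sequentially. \<bar>u \<omega>\<bar> \<le> real (Suc n)"
        using eventually_ge_at_top[of "nat \<lceil>\<bar>u \<omega>\<bar>\<rceil>"]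
        by eventually_elim linarith
      ultimately have "\<forall>\<^sub>F n in sequentially. ennreal \<bar>u \<omega> * indicator (space M - K n) \<omega>\<bar> = 0"
        by eventually_elim (use that in \<open>simp add: K_def indicator_def\<close>)
      then show ?thesis by (rule tendsto_eventually)
    qed simp
    then show "AE \<omega> in M. (\<lambda>n. ennreal \<bar>u \<omega> * indicator (space M - K n) \<omega>\<bar>) \<longlonglongrightarrow> 0"
      by simp
    show "AE \<omega> in M. ennreal \<bar>u \<omega> * indicator (space M - K n) \<omega>\<bar> \<le> ennreal \<bar>u \<omega>\<bar>" for n
      by (auto simp: indicator_def)
  qed auto
  from order_tendstoD(2)[OF this, of "ennreal (\<epsilon> / 3)"] \<epsilon>
  obtain n where n: "L1_norm M (\<lambda>\<omega>. u \<omega> * indicator (space M - K n) \<omega>) < ennreal (\<epsilon> / 3)"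
    unfolding L1_norm_def eventually_sequentially by auto
  have fin: "emeasure M (K n) < \<infinity>"
  proof -
    have "emeasure M (K n) \<le> emeasure M {\<omega> \<in> space M. 1 \<le> ennreal (real (Suc n)) * ennreal \<bar>u \<omega>\<bar>}"
    proof (intro emeasure_mono subsetI)
      fix \<omega> assume "\<omega> \<in> K n"
      then have "1 \<le> real (Suc n) * \<bar>u \<omega>\<bar>" "\<omega> \<in> space M"
        by (auto simp: K_def field_simps)
      from ennreal_leI[OF this(1)] this(2) show "\<omega> \<in> {\<omega> \<in> space M. 1 \<le> ennreal (real (Suc n)) * ennreal \<bar>u \<omega>\<bar>}"
        by (simp add: ennreal_mult del: of_nat_Suc)
    qed measurable
    also have "\<dots> \<le> ennreal (real (Suc n)) * (\<integral>\<^sup>+ \<omega>. ennreal \<bar>u \<omega>\<bar> * indicator (space M) \<omega> \<partial>M)"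
      using nn_integral_Markov_inequality[of "\<lambda>\<omega>. ennreal \<bar>u \<omega>\<bar>" "space M" M] by simp
    also have "\<dots> = ennreal (real (Suc n)) * (\<integral>\<^sup>+ \<omega>. ennreal \<bar>u \<omega>\<bar> \<partial>M)"
      by (intro arg_cong2[where f = "(*)"] refl nn_integral_cong) auto
    also have "\<dots> < \<infinity>"
      using u by (simp add: integrable_iff_bounded ennreal_mult_less_top)
    finally show ?thesis .
  qed
  have small: "L1_norm M (\<lambda>\<omega>. u \<omega> * indicator A \<omega>) < ennreal \<epsilon>"
    if [measurable]: "A \<in> sets M" and A: "emeasure M A \<le> ennreal (\<epsilon> / (3 * Suc n))" for A
  proof -
    have "L1_norm M (\<lambda>\<omega>. u \<omega> * indicator A \<omega>)
      \<le> L1_norm M (\<lambda>\<omega>. u \<omega> * indicator (space M - K n) \<omega>)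
        + L1_norm M (\<lambda>\<omega>. real (Suc n) * indicator A \<omega>)"
      by (rule L1_norm_indicator_le) (auto simp: indicator_def K_def)
    also have "L1_norm M (\<lambda>\<omega>. real (Suc n) * indicator A \<omega>) = ennreal (Suc n) * emeasure M A"
    proof -
      have "L1_norm M (\<lambda>\<omega>. real (Suc n) * indicator A \<omega>) = (\<integral>\<^sup>+ \<omega>. ennreal (Suc n) * indicator A \<omega> \<partial>M)"
        unfolding L1_norm_def by (intro nn_integral_cong) (auto simp: indicator_def)
      then show ?thesis by (simp add: nn_integral_cmult_indicator)
    qed
    also have "\<dots> \<le> ennreal (Suc n) * ennreal (\<epsilon> / (3 * Suc n))"
      using A by (intro mult_left_mono) auto
    also have "\<dots> = ennreal (\<epsilon> / 3)"
      using \<epsilon> by (subst ennreal_mult[symmetric]) (auto simp: field_simps)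
    also have "L1_norm M (\<lambda>\<omega>. u \<omega> * indicator (space M - K n) \<omega>) + ennreal (\<epsilon> / 3)
        \<le> ennreal (\<epsilon> / 3) + ennreal (\<epsilon> / 3)"
      using n by (intro add_right_mono) simp
    also have "\<dots> < ennreal \<epsilon>"
      using \<epsilon> by (simp flip: ennreal_plus add: ennreal_lessI)
    finally show ?thesis by (simp add: add_left_mono)
  qed
  show "\<exists>\<eta>>0. \<exists>K\<in>sets M. emeasure M K < \<infinity> \<and>
        (\<forall>A\<in>sets M. emeasure M A \<le> ennreal \<eta> \<longrightarrow>
           (SUP v\<in>{u}. L1_norm M (\<lambda>\<omega>. v \<omega> * indicator A \<omega>)) < ennreal \<epsilon>) \<and>
        (SUP v\<in>{u}. L1_norm M (\<lambda>\<omega>. v \<omega> * indicator (space M - K) \<omega>)) < ennreal \<epsilon>"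
  proof (intro exI[of _ "\<epsilon> / (3 * Suc n)"] conjI bexI[of _ "K n"] ballI impI)
    show "(SUP v\<in>{u}. L1_norm M (\<lambda>\<omega>. v \<omega> * indicator (space M - K n) \<omega>)) < ennreal \<epsilon>"
      using less_trans[OF n, of "ennreal \<epsilon>"] \<epsilon> by (simp add: ennreal_lessI)
  qed (use small \<epsilon> fin in auto)
qed

lemma uniformly_integrable_finite:
  assumes "finite X" and "\<And>u. u \<in> X \<Longrightarrow> integrable M u"
  shows "uniformly_integrable M X"
  using assms
proof (induction rule: finite_induct)
  case empty
  show ?case
    unfolding uniformly_integrable_def
    by (auto simp: bot_ennreal intro!: exI[of _ 1] bexI[of _ "{}"])
next
  case (insert u X)
  then show ?case
    using uniformly_integrable_Un[OF uniformly_integrable_singleton[of M u], of X] by simp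
qed

text \<open>
  Both conditions defining uniform integrability, and boundedness too, are bounds on integrals of
  \<open>\<bar>v\<bar>\<close> over suitable measurable sets. Each passes from \<open>Y\<close> to \<open>X\<close> with an error \<open>\<epsilon>\<close> that does not
  depend on the set.
\<close>

lemma uniformly_integrable_approx:
  assumes int: "\<And>v. v \<in> X \<Longrightarrow> integrable M v"
    and approx: "\<And>\<epsilon>::real. \<epsilon> > 0 \<Longrightarrow> \<exists>Y. uniformly_integrable M Y \<and>
      (\<forall>v\<in>X. \<exists>h\<in>borel_measurable M. \<exists>u\<in>Y. L1_norm M h \<le> ennreal \<epsilon> \<and>
         (AE \<omega> in M. \<bar>v \<omega>\<bar> \<le> \<bar>h \<omega>\<bar> + \<bar>u \<omega>\<bar>))"
  shows "uniformly_integrable M X"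
proof -
  have transfer: "(SUP v\<in>X. L1_norm M (\<lambda>\<omega>. v \<omega> * indicator A \<omega>))
      \<le> ennreal \<epsilon> + (SUP u\<in>Y. L1_norm M (\<lambda>\<omega>. u \<omega> * indicator A \<omega>))"
    if Y: "uniformly_integrable M Y" and A: "A \<in> sets M"
      and XY: "\<forall>v\<in>X. \<exists>h\<in>borel_measurable M. \<exists>u\<in>Y. L1_norm M h \<le> ennreal \<epsilon> \<and>
         (AE \<omega> in M. \<bar>v \<omega>\<bar> \<le> \<bar>h \<omega>\<bar> + \<bar>u \<omega>\<bar>)" for Y A \<epsilon>
  proof (rule SUP_least)
    fix v assume "v \<in> X"
    then obtain h u where h: "h \<in> borel_measurable M" "L1_norm M h \<le> ennreal \<epsilon>" and u: "u \<in> Y"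
      and le: "AE \<omega> in M. \<bar>v \<omega>\<bar> \<le> \<bar>h \<omega>\<bar> + \<bar>u \<omega>\<bar>"
      using XY by metis
    have "u \<in> borel_measurable M"
      using Y u by (auto simp: uniformly_integrable_def)
    from L1_norm_indicator_le[OF h(1) this A le]
    have "L1_norm M (\<lambda>\<omega>. v \<omega> * indicator A \<omega>)
        \<le> L1_norm M h + L1_norm M (\<lambda>\<omega>. u \<omega> * indicator A \<omega>)" .
    also have "\<dots> \<le> ennreal \<epsilon> + (SUP u\<in>Y. L1_norm M (\<lambda>\<omega>. u \<omega> * indicator A \<omega>))"
      using h(2) u by (intro add_mono SUP_upper)
    finally show "L1_norm M (\<lambda>\<omega>. v \<omega> * indicator A \<omega>)
        \<le> ennreal \<epsilon> + (SUP u\<in>Y. L1_norm M (\<lambda>\<omega>. u \<omega> * indicator A \<omega>))" .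
  qed
  show ?thesis
    unfolding uniformly_integrable_def
  proof (intro conjI allI impI)
    show "\<forall>v\<in>X. integrable M v" using int by simp
    obtain Y where Y: "uniformly_integrable M Y"
      and XY: "\<forall>v\<in>X. \<exists>h\<in>borel_measurable M. \<exists>u\<in>Y. L1_norm M h \<le> ennreal 1 \<and>
         (AE \<omega> in M. \<bar>v \<omega>\<bar> \<le> \<bar>h \<omega>\<bar> + \<bar>u \<omega>\<bar>)"
      using approx[of 1] by auto
    have space: "L1_norm M (\<lambda>\<omega>. v \<omega> * indicator (space M) \<omega>) = L1_norm M v" for v :: "'a \<Rightarrow> real"
      unfolding L1_norm_def by (intro nn_integral_cong) auto
    have "(SUP v\<in>X. L1_norm M v) \<le> ennreal 1 + (SUP u\<in>Y. L1_norm M u)"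
      using transfer[OF Y sets.top XY] by (simp only: space)
    also have "\<dots> < \<infinity>"
      using Y by (simp add: uniformly_integrable_def)
    finally show "(SUP v\<in>X. L1_norm M v) < \<infinity>" .
  next
    fix \<epsilon> :: real assume \<epsilon>: "\<epsilon> > 0"
    then obtain Y where Y: "uniformly_integrable M Y"
      and XY: "\<forall>v\<in>X. \<exists>h\<in>borel_measurable M. \<exists>u\<in>Y. L1_norm M h \<le> ennreal (\<epsilon> / 2) \<and>
         (AE \<omega> in M. \<bar>v \<omega>\<bar> \<le> \<bar>h \<omega>\<bar> + \<bar>u \<omega>\<bar>)"
      using approx[of "\<epsilon> / 2"] by auto
    obtain \<eta> K where \<eta>: "\<eta> > 0" and K: "K \<in> sets M" "emeasure M K < \<infinity>"
      and \<eta>Y: "\<forall>A\<in>sets M. emeasure M A \<le> ennreal \<eta> \<longrightarrow>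
        (SUP u\<in>Y. L1_norm M (\<lambda>\<omega>. u \<omega> * indicator A \<omega>)) < ennreal (\<epsilon> / 2)"
      and KY: "(SUP u\<in>Y. L1_norm M (\<lambda>\<omega>. u \<omega> * indicator (space M - K) \<omega>)) < ennreal (\<epsilon> / 2)"
      by (rule uniformly_integrableE[OF Y half_gt_zero[OF \<epsilon>]], rule that)
    have bound: "(SUP v\<in>X. L1_norm M (\<lambda>\<omega>. v \<omega> * indicator A \<omega>)) < ennreal \<epsilon>"
      if A: "A \<in> sets M"
        and less: "(SUP u\<in>Y. L1_norm M (\<lambda>\<omega>. u \<omega> * indicator A \<omega>)) < ennreal (\<epsilon> / 2)" for A
    proof -
      have "(SUP v\<in>X. L1_norm M (\<lambda>\<omega>. v \<omega> * indicator A \<omega>))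
          \<le> ennreal (\<epsilon> / 2) + (SUP u\<in>Y. L1_norm M (\<lambda>\<omega>. u \<omega> * indicator A \<omega>))"
        by (rule transfer[OF Y A XY])
      also have "\<dots> < ennreal (\<epsilon> / 2) + ennreal (\<epsilon> / 2)"
        using less by (simp add: ennreal_add_left_cancel_less)
      also have "\<dots> = ennreal \<epsilon>"
        using \<epsilon> by (simp flip: ennreal_plus)
      finally show ?thesis .
    qed
    show "\<exists>\<eta>>0. \<exists>K\<in>sets M. emeasure M K < \<infinity> \<and>
        (\<forall>A\<in>sets M. emeasure M A \<le> ennreal \<eta> \<longrightarrow>
           (SUP v\<in>X. L1_norm M (\<lambda>\<omega>. v \<omega> * indicator A \<omega>)) < ennreal \<epsilon>) \<and>
        (SUP v\<in>X. L1_norm M (\<lambda>\<omega>. v \<omega> * indicator (space M - K) \<omega>)) < ennreal \<epsilon>"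
      using \<eta> K bound \<eta>Y KY by (intro exI[of _ \<eta>] conjI bexI[of _ K]) auto
  qed
qed

section \<open>Norm bounded sequences\<close>

lemma young_function_contraction_le:
  assumes "young_function \<psi>" and "0 \<le> c" "c \<le> 1"
  shows "\<psi> (c *\<^sub>R y) \<le> \<psi> y"
proof -
  have "\<psi> ((1 - c) *\<^sub>R 0 + c *\<^sub>R y) \<le> ereal (1 - c) * \<psi> 0 + ereal c * \<psi> y"
    using assms unfolding young_function_def by blast
  also have "\<dots> = ereal c * \<psi> y"
    using assms by (simp add: young_function_def)
  also have "\<dots> \<le> 1 * \<psi> y"
    using assms by (intro ereal_mult_right_mono) (auto simp: young_function_def one_ereal_def)
  finally show ?thesis by simp
qed

text \<open>
  The infimum defining the norm need not be attained, so \<open>x\<close> lies in \<open>s {I\<^sub>\<phi> \<le> 1}\<close> for some \<open>s\<close> below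
  the strict bound \<open>t\<close>, and a Young function decreases when its argument shrinks by the factor
  \<open>s / t\<close>. Likewise the infimum defining the upper integral need not be attained; any bound
  larger than 1 serves in place of 2.
\<close>

lemma L_phi_majorant:
  assumes \<phi>: "young_integrand M \<phi>" and x: "x \<in> L_phi M \<phi>" and t: "norm_phi M \<phi> x < t"
  obtains g where "integrable M g" "(\<integral>\<omega>. g \<omega> \<partial>M) \<le> 2"
    "AE \<omega> in M. \<phi> (\<omega>, inverse t *\<^sub>R x \<omega>) \<le> ereal (g \<omega>)"
proof -
  have "{s. s > 0 \<and> x \<in> dilated_ball M \<phi> s} \<noteq> {}"
    using x by (auto simp: L_phi_def)
  with t obtain s where s: "0 < s" "s < t" "x \<in> dilated_ball M \<phi> s"
    unfolding norm_phi_def by (metis (mono_tags, lifting) cInf_lessD mem_Collect_eq)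
  then obtain y where xy: "x = (\<lambda>\<omega>. s *\<^sub>R y \<omega>)" and y: "I_phi M \<phi> y \<le> 1"
    unfolding dilated_ball_def by auto
  have "upper_integral M (\<lambda>\<omega>. \<phi> (\<omega>, y \<omega>)) < ereal 2"
    using y unfolding I_phi_def by (rule le_less_trans) (simp add: one_ereal_def)
  then obtain g where g: "integrable M g" "AE \<omega> in M. \<phi> (\<omega>, y \<omega>) \<le> ereal (g \<omega>)"
    and int: "ereal (\<integral>\<omega>. g \<omega> \<partial>M) < ereal 2"
    unfolding upper_integral_def INF_less_iff by blast
  have "(\<integral>\<omega>. g \<omega> \<partial>M) \<le> 2"
    using int by simp
  moreover have "AE \<omega> in M. \<phi> (\<omega>, inverse t *\<^sub>R x \<omega>) \<le> ereal (g \<omega>)"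
    using g(2)
  proof (rule AE_mp, intro AE_I2 impI)
    fix \<omega> assume "\<omega> \<in> space M" and le: "\<phi> (\<omega>, y \<omega>) \<le> ereal (g \<omega>)"
    then have "\<phi> (\<omega>, (s / t) *\<^sub>R y \<omega>) \<le> \<phi> (\<omega>, y \<omega>)"
      using \<phi> s young_function_contraction_le[of "\<lambda>e. \<phi> (\<omega>, e)" "s / t"]
      by (auto simp: young_integrand_def)
    with le show "\<phi> (\<omega>, inverse t *\<^sub>R x \<omega>) \<le> ereal (g \<omega>)"
      by (auto simp: xy divide_inverse mult.commute intro: order_trans)
  qed
  ultimately show ?thesis using g(1) that by blast
qed

section \<open>Lower compactness\<close>

lemma real_neg_part_bound:
  assumes "- a - ereal b \<le> c" and "a \<le> ereal d" and "0 \<le> a" and "0 \<le> b"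
  shows "neg_part c = ereal (real_of_ereal (neg_part c))"
    "\<bar>real_of_ereal (neg_part c)\<bar> \<le> d + b"
proof -
  have le: "neg_part c \<le> ereal (d + b)"
    using assms by (cases a; cases c) (auto simp: neg_part_def max_def)
  have ge: "0 \<le> neg_part c" by (simp add: neg_part_def)
  show "neg_part c = ereal (real_of_ereal (neg_part c))"
    using le ge by (cases "neg_part c") auto
  show "\<bar>real_of_ereal (neg_part c)\<bar> \<le> d + b"
    using le ge by (cases "neg_part c") auto
qed

lemma borel_measurable_neg_part_diff_quotient:
  fixes f :: "'a \<times> 'e::{banach, second_countable_topology} \<Rightarrow> ereal"
  assumes f: "measurable_integrand M f"
    and [measurable]: "x0 \<in> borel_measurable M" "x \<in> borel_measurable M"
  shows "(\<lambda>\<omega>. neg_part (diff_quotient f x0 r (\<omega>, x \<omega>))) \<in> borel_measurable M"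
proof -
  have [measurable]: "f \<in> borel_measurable (M \<Otimes>\<^sub>M borel)"
    using f by (simp add: measurable_integrand_def)
  show ?thesis
    unfolding neg_part_def diff_quotient_def by simp
qed

theorem proposition8p11:
  fixes M :: "'a measure"
    and \<phi> f :: "'a \<times> 'e::{banach, second_countable_topology} \<Rightarrow> ereal"
    and x0 :: "'a \<Rightarrow> 'e"
  assumes "sigma_finite_measure M"
    and "complete_measure M"
    and "young_integrand M \<phi>"
    and "measurable_integrand M f"
    and "x0 \<in> L_phi M \<phi>"
    and "AE \<omega> in M. \<bar>f (\<omega>, x0 \<omega>)\<bar> \<noteq> \<infinity>"
    and "\<And>\<epsilon> l :: real. \<epsilon> > 0 \<Longrightarrow> l > 0 \<Longrightarrow>
      \<exists>u :: real \<Rightarrow> 'a \<Rightarrow> real.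
        (\<forall>r\<in>{0<..<1}. \<forall>\<omega>\<in>space M. 0 \<le> u r \<omega>) \<and>
        (\<exists>\<delta>\<in>{0<..<1}. uniformly_integrable M (u ` {0<..<\<delta>})) \<and>
        (\<forall>\<^sub>F r in at_right 0. integrand_ge M (diff_quotient f x0 r)
           (\<lambda>(\<omega>, e). - (ereal \<epsilon> * scaled_integrand \<phi> l (\<omega>, e)) - ereal (u r \<omega>)))"
  shows "frechet_lower_compactness M (L_phi M \<phi>) (norm_phi M \<phi>) f x0"
  unfolding frechet_lower_compactness_def
proof (intro allI impI, elim conjE exE)
  fix r :: "nat \<Rightarrow> real" and x :: "nat \<Rightarrow> 'a \<Rightarrow> 'e" and C :: real
  assume r_pos: "\<forall>n. r n > 0" and r_lim: "r \<longlonglongrightarrow> 0"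
    and x: "\<forall>n. x n \<in> L_phi M \<phi>" and C: "\<forall>n. norm_phi M \<phi> (x n) \<le> C"
  define t where "t = \<bar>C\<bar> + 1"
  define v where "v n \<omega> = real_of_ereal (neg_part (diff_quotient f x0 (r n) (\<omega>, x n \<omega>)))" for n \<omega>
  have t: "t > 0" "norm_phi M \<phi> (x n) < t" for n
    using C[rule_format, of n] by (auto simp: t_def)
  have "\<forall>n. \<exists>g. integrable M g \<and> (\<integral>\<omega>. g \<omega> \<partial>M) \<le> 2 \<and>
      (AE \<omega> in M. \<phi> (\<omega>, inverse t *\<^sub>R x n \<omega>) \<le> ereal (g \<omega>))"
    using L_phi_majorant[OF assms(3) _ t(2)] x by metis
  then obtain g where g: "\<And>n. integrable M (g n)" "\<And>n. (\<integral>\<omega>. g n \<omega> \<partial>M) \<le> 2"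
    "\<And>n. AE \<omega> in M. \<phi> (\<omega>, inverse t *\<^sub>R x n \<omega>) \<le> ereal (g n \<omega>)"
    by metis
  have \<phi>_nonneg: "0 \<le> \<phi> (\<omega>, e)" if "\<omega> \<in> space M" for \<omega> e
    using assms(3) that by (auto simp: young_integrand_def young_function_def)
  have g_nonneg: "AE \<omega> in M. 0 \<le> g n \<omega>" for n
    using g(3)[of n]
  proof (rule AE_mp, intro AE_I2 impI)
    fix \<omega> assume "\<omega> \<in> space M" "\<phi> (\<omega>, inverse t *\<^sub>R x n \<omega>) \<le> ereal (g n \<omega>)"
    with order_trans[OF \<phi>_nonneg this(2)] show "0 \<le> g n \<omega>" by simp
  qed
  have v_measurable: "v n \<in> borel_measurable M" for n
    unfolding v_def
    using borel_measurable_neg_part_diff_quotient[OF assms(4), of x0 "x n" "r n"] assms(5) x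
    by (auto simp: L_phi_def)
  have r_right: "filterlim r (at_right 0) sequentially"
    using r_pos r_lim by (auto simp: filterlim_at less_imp_neq[symmetric] intro!: always_eventually)
  have bound: "\<exists>Y N. uniformly_integrable M Y \<and> (\<forall>n\<ge>N. \<exists>w\<in>Y. AE \<omega> in M.
      neg_part (diff_quotient f x0 (r n) (\<omega>, x n \<omega>)) = ereal (v n \<omega>) \<and>
      \<bar>v n \<omega>\<bar> \<le> \<epsilon> * g n \<omega> + w \<omega>)" if \<epsilon>: "\<epsilon> > 0" for \<epsilon> :: real
  proof -
    have "inverse t > 0" using t(1) by simp
    from assms(7)[OF \<epsilon> this]
    obtain u \<delta> where u: "\<forall>r\<in>{0<..<1}. \<forall>\<omega>\<in>space M. 0 \<le> u r \<omega>"
      and \<delta>: "\<delta> \<in> {0<..<1}" "uniformly_integrable M (u ` {0<..<\<delta>})"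
      and ev: "\<forall>\<^sub>F r in at_right 0. integrand_ge M (diff_quotient f x0 r)
           (\<lambda>(\<omega>, e). - (ereal \<epsilon> * scaled_integrand \<phi> (inverse t) (\<omega>, e)) - ereal (u r \<omega>))"
      by blast
    have "\<forall>\<^sub>F s in at_right 0. s \<in> {0<..<\<delta>}"
      using \<delta>(1) by (intro eventually_at_right_real) auto
    with ev have "\<forall>\<^sub>F s in at_right 0. s \<in> {0<..<\<delta>} \<and> integrand_ge M (diff_quotient f x0 s)
           (\<lambda>(\<omega>, e). - (ereal \<epsilon> * scaled_integrand \<phi> (inverse t) (\<omega>, e)) - ereal (u s \<omega>))"
      by eventually_elim simp
    from eventually_compose_filterlim[OF this r_right]
    obtain N where N: "\<And>n. n \<ge> N \<Longrightarrow> r n \<in> {0<..<\<delta>}"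
      "\<And>n. n \<ge> N \<Longrightarrow> integrand_ge M (diff_quotient f x0 (r n))
           (\<lambda>(\<omega>, e). - (ereal \<epsilon> * scaled_integrand \<phi> (inverse t) (\<omega>, e)) - ereal (u (r n) \<omega>))"
      unfolding eventually_sequentially by blast
    have "AE \<omega> in M. neg_part (diff_quotient f x0 (r n) (\<omega>, x n \<omega>)) = ereal (v n \<omega>) \<and>
      \<bar>v n \<omega>\<bar> \<le> \<epsilon> * g n \<omega> + u (r n) \<omega>" if n: "n \<ge> N" for n
      using N(2)[OF n, unfolded integrand_ge_def] g(3)[of n] AE_space
    proof eventually_elim
      case (elim \<omega>)
      let ?a = "ereal \<epsilon> * \<phi> (\<omega>, inverse t *\<^sub>R x n \<omega>)"
      have "- ?a - ereal (u (r n) \<omega>) \<le> diff_quotient f x0 (r n) (\<omega>, x n \<omega>)"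
        using elim(1)[rule_format, of "x n \<omega>"] by (simp add: scaled_integrand_def)
      moreover have "?a \<le> ereal (\<epsilon> * g n \<omega>)"
        using ereal_mult_left_mono[OF elim(2), of "ereal \<epsilon>"] \<epsilon> by simp
      moreover have "0 \<le> ?a"
        using \<phi>_nonneg[OF elim(3)] \<epsilon> by simp
      moreover have "0 \<le> u (r n) \<omega>"
        using u N(1)[OF n] \<delta>(1) elim(3) by simp
      ultimately show ?case
        unfolding v_def using real_neg_part_bound by blast
    qed
    with \<delta>(2) N(1) show ?thesis by blast
  qed
  obtain Y1 n0 where Y1: "uniformly_integrable M Y1"
    and n0: "\<And>n. n \<ge> n0 \<Longrightarrow> \<exists>w\<in>Y1. AE \<omega> in M.
      neg_part (diff_quotient f x0 (r n) (\<omega>, x n \<omega>)) = ereal (v n \<omega>) \<and> \<bar>v n \<omega>\<bar> \<le> 1 * g n \<omega> + w \<omega>"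
    using bound[of 1] by auto
  have v_int: "integrable M (v n)" if n: "n \<ge> n0" for n
  proof -
    obtain w where w: "w \<in> Y1" "AE \<omega> in M. \<bar>v n \<omega>\<bar> \<le> 1 * g n \<omega> + w \<omega>"
      using n0[OF n] by auto
    have "integrable M (\<lambda>\<omega>. 1 * g n \<omega> + w \<omega>)"
      using Y1 w(1) g(1)[of n] by (auto simp: uniformly_integrable_def)
    then show ?thesis
      using v_measurable by (rule Bochner_Integration.integrable_bound) (use w(2) in auto)
  qed
  have "uniformly_integrable M (v ` {n0..})"
  proof (rule uniformly_integrable_approx)
    fix \<epsilon> :: real assume \<epsilon>: "\<epsilon> > 0"
    \<comment> \<open>Half of \<open>\<epsilon>\<close>, because the integral of \<open>g n\<close> is only bounded by 2.\<close>
    obtain Y N where Y: "uniformly_integrable M Y" and N: "\<And>n. n \<ge> N \<Longrightarrow> \<exists>w\<in>Y. AE \<omega> in M.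
        neg_part (diff_quotient f x0 (r n) (\<omega>, x n \<omega>)) = ereal (v n \<omega>) \<and>
        \<bar>v n \<omega>\<bar> \<le> \<epsilon> / 2 * g n \<omega> + w \<omega>"
      using bound[of "\<epsilon> / 2"] \<epsilon> by auto
    \<comment> \<open>The functions with index below \<open>N\<close>, on which the growth condition says nothing for this
       \<open>\<epsilon>\<close>, are put into the dominating family themselves.\<close>
    have "uniformly_integrable M (Y \<union> v ` {n0..<N})"
      using v_int by (intro uniformly_integrable_Un Y uniformly_integrable_finite) auto
    moreover have "\<exists>h\<in>borel_measurable M. \<exists>w\<in>Y \<union> v ` {n0..<N}. L1_norm M h \<le> ennreal \<epsilon> \<and>
         (AE \<omega> in M. \<bar>v n \<omega>\<bar> \<le> \<bar>h \<omega>\<bar> + \<bar>w \<omega>\<bar>)" if n: "n \<ge> n0" for n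
    proof (cases "n < N")
      case True
      with n show ?thesis
        by (intro bexI[of _ "\<lambda>_. 0"] bexI[of _ "v n"]) (auto simp: L1_norm_def)
    next
      case False
      then obtain w where w: "w \<in> Y" "AE \<omega> in M. \<bar>v n \<omega>\<bar> \<le> \<epsilon> / 2 * g n \<omega> + w \<omega>"
        using N[of n] by auto
      have "L1_norm M (\<lambda>\<omega>. \<epsilon> / 2 * g n \<omega>) = (\<integral>\<^sup>+ \<omega>. ennreal (\<epsilon> / 2 * g n \<omega>) \<partial>M)"
        unfolding L1_norm_def using g_nonneg[of n] \<epsilon>
        by (intro nn_integral_cong_AE) (auto elim!: eventually_mono)
      also have "\<dots> = ennreal (\<integral>\<omega>. \<epsilon> / 2 * g n \<omega> \<partial>M)"
        using g(1)[of n] g_nonneg[of n] \<epsilon>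
        by (intro nn_integral_eq_integral) (auto elim!: eventually_mono)
      also have "\<dots> \<le> ennreal \<epsilon>"
        using g(2)[of n] \<epsilon> by (auto intro!: ennreal_leI)
      finally have "L1_norm M (\<lambda>\<omega>. \<epsilon> / 2 * g n \<omega>) \<le> ennreal \<epsilon>" .
      moreover have "AE \<omega> in M. \<bar>v n \<omega>\<bar> \<le> \<bar>\<epsilon> / 2 * g n \<omega>\<bar> + \<bar>w \<omega>\<bar>"
        using w(2) by eventually_elim linarith
      moreover have "(\<lambda>\<omega>. \<epsilon> / 2 * g n \<omega>) \<in> borel_measurable M"
        using g(1)[of n] by auto
      ultimately show ?thesis
        using w(1) by blast
    qed
    ultimately show "\<exists>Y. uniformly_integrable M Y \<and>
      (\<forall>v\<in>v ` {n0..}. \<exists>h\<in>borel_measurable M. \<exists>u\<in>Y. L1_norm M h \<le> ennreal \<epsilon> \<and>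
         (AE \<omega> in M. \<bar>v \<omega>\<bar> \<le> \<bar>h \<omega>\<bar> + \<bar>u \<omega>\<bar>))"
      by (intro exI[of _ "Y \<union> v ` {n0..<N}"]) auto
  qed (use v_int in auto)
  moreover have "AE \<omega> in M. neg_part (diff_quotient f x0 (r n) (\<omega>, x n \<omega>)) = ereal (v n \<omega>)"
    if "n \<ge> n0" for n
    using n0[OF that] by auto
  ultimately show "\<exists>n0 v. (\<forall>n\<ge>n0. AE \<omega> in M.
        neg_part (diff_quotient f x0 (r n) (\<omega>, x n \<omega>)) = ereal (v n \<omega>)) \<and>
      uniformly_integrable M (v ` {n0..})"
    by blast
qed

end
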